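(* Let $\xi$ be a standard normally distributed random variable. For no $p>0$ does there exist a constant $C>0$ such that the inequality $$\limsup_{n\to\infty}K\Big(\xi,\sum_{k=1}^n\xi_{n,k}\Big)\le C\,\big[\mathrm{Lin}(\{\xi_{n,k}\})\big]^{1+p}$$ holds for every standard triangular array $\{\xi_{n,k}\}$ satisfying Feller's negligibility condition.
   Context: A standard triangular array (STA) is a triangular array $\{\xi_{n,k}\}_{n\ge 1,\,1\le k\le n}$ of real square-integrable random variables such that: (a) for each $n$, $\xi_{n,1},\dots,\xi_{n,n}$ are independent; (b) $\mathbb{E}[\xi_{n,k}]=0$ for all $n,k$; (c) $\sum_{k=1}^n\sigma_{n,k}^2=1$ for all $n$, where $\sigma_{n,k}^2=\mathbb{E}[\xi_{n,k}^2]$. It satisfies Feller's negligibility condition if $\max_{1\le k\le n}\sigma_{n,k}^2\to 0$ as $n\to\infty$. The Kolmogorov distance between random variables is $K(\eta,\eta')=\sup_{x\in\mathbb{R}}|\mathbb{P}[\eta\le x]-\mathbb{P}[\eta'\le x]|$. Write $\mathbb{E}[X;A]=\mathbb{E}[X1_A]$. The Lindeberg index is $$\mathrm{Lin}(\{\xi_{n,k}\})=\sup_{\epsilon>0}\limsup_{n\to\infty}\sum_{k=1}^n\mathbb{E}\big[\xi_{n,k}^2;|\xi_{n,k}|\ge\epsilon\big].$$ *)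

theory Defs
  imports "HOL-Probability.Probability"
begin

text \<open>An array is a function \<open>X :: nat \<Rightarrow> nat \<Rightarrow> 'a \<Rightarrow> real\<close>; only the entries \<open>X n k\<close> with
  \<open>1 \<le> n\<close> and \<open>k \<in> {1..n}\<close> are constrained.  All entries live on one probability space; no relation
  between different rows is imposed.\<close>

definition standard_triangular_array :: "'a measure \<Rightarrow> (nat \<Rightarrow> nat \<Rightarrow> 'a \<Rightarrow> real) \<Rightarrow> bool" where
  "standard_triangular_array M X \<longleftrightarrow>
     prob_space M \<and>
     (\<forall>n\<ge>1. \<forall>k\<in>{1..n}. X n k \<in> borel_measurable M \<and> integrable M (\<lambda>\<omega>. (X n k \<omega>)\<^sup>2)) \<and>
     (\<forall>n\<ge>1. prob_space.indep_vars M (\<lambda>_. borel) (X n) {1..n}) \<and>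
     (\<forall>n\<ge>1. \<forall>k\<in>{1..n}. (\<integral>\<omega>. X n k \<omega> \<partial>M) = 0) \<and>
     (\<forall>n\<ge>1. (\<Sum>k=1..n. \<integral>\<omega>. (X n k \<omega>)\<^sup>2 \<partial>M) = 1)"

definition feller_negligible :: "'a measure \<Rightarrow> (nat \<Rightarrow> nat \<Rightarrow> 'a \<Rightarrow> real) \<Rightarrow> bool" where
  "feller_negligible M X \<longleftrightarrow>
     (\<lambda>n. Max ((\<lambda>k. \<integral>\<omega>. (X n k \<omega>)\<^sup>2 \<partial>M) ` {1..n})) \<longlonglongrightarrow> 0"

text \<open>The two random variables may live on different probability spaces.\<close>

definition kolmogorov_dist ::
    "'a measure \<Rightarrow> ('a \<Rightarrow> real) \<Rightarrow> 'b measure \<Rightarrow> ('b \<Rightarrow> real) \<Rightarrow> real" where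
  "kolmogorov_dist M X N Y =
     (SUP x::real. \<bar>measure M {\<omega>\<in>space M. X \<omega> \<le> x} - measure N {\<omega>\<in>space N. Y \<omega> \<le> x}\<bar>)"

text \<open>For a standard triangular array the index lies in \<open>[0, 1]\<close>, so converting it to a real
  number loses nothing.\<close>

definition lindeberg_index :: "'a measure \<Rightarrow> (nat \<Rightarrow> nat \<Rightarrow> 'a \<Rightarrow> real) \<Rightarrow> ereal" where
  "lindeberg_index M X =
     (SUP \<epsilon>\<in>{0::real<..}. limsup (\<lambda>n. ereal
        (\<Sum>k=1..n. LINT \<omega>:{\<omega>\<in>space M. \<bar>X n k \<omega>\<bar> \<ge> \<epsilon>}|M. (X n k \<omega>)\<^sup>2)))"

text \<open>HOL cannot quantify over sample-space types inside a formula.  Standardness, negligibility,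
  the Lindeberg index and the Kolmogorov distances depend only on the joint law of an array, and
  that law can be realized on the following coordinate type (with any measure and sigma-algebra), so
  quantifying over arrays on this type is no restriction.\<close>

type_synonym sample = "nat \<times> nat \<Rightarrow> real"

end

theory Submission
  imports Defs
begin

text \<open>
  The Lindeberg index weighs a rare large jump by its variance, whereas the Kolmogorov distance only
  sees its probability.  The two differ by a factor \<open>a\<^sup>2\<close>, where \<open>a\<close> is the size of the jump.
  This factor can be kept below any given negative power of the index, and yet \<open>a\<close> be so large that
  the mass of the normal distribution beyond \<open>a / 2\<close> is negligible.

  Concretely, row \<open>n\<close> of the array consists of \<open>n\<close> independent copies of a symmetric variable with
  values \<open>\<plusminus>a\<close> and \<open>\<plusminus>s\<close>.  An entry jumps, that is, equals \<open>\<plusminus>a\<close>, with probability \<open>q = \<theta> / (n a\<^sup>2)\<close>, so the jumps of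
  the whole row contribute variance \<open>\<theta>\<close>; the value \<open>s\<close>, of order \<open>n\<^sup>-\<^sup>1\<^sup>/\<^sup>2\<close>, supplies the rest.
  The array satisfies Feller's condition, and its Lindeberg index is at most \<open>\<theta>\<close>
  (\<open>jump_array_exists\<close>).  No central limit theorem is needed to see that the row sum \<open>S\<^sub>n\<close> is not
  normal: some entry jumps with probability about \<open>\<theta> / a\<^sup>2\<close>, and by symmetry
  the other entries undo the jump at most half of the time (\<open>levy_symmetrization\<close>), so that
  \<open>P (\<bar>S\<^sub>n\<bar> \<ge> a) \<ge> \<theta> / (4 a\<^sup>2)\<close> for every \<open>n\<close>.

  Comparing this with the normal tail, which by Markov's inequality for a high moment is at most
  \<open>c (a / 2)\<^sup>-\<^sup>2\<^sup>m\<close>, shows that the Kolmogorov distance is at least half of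
  \<open>\<theta> / (4 a\<^sup>2) - c (a / 2)\<^sup>-\<^sup>2\<^sup>m\<close>.  With \<open>\<theta> = a\<^sup>-\<^sup>3\<^sup>/\<^sup>p\<close> the leading term is of order
  \<open>\<theta> a\<^sup>-\<^sup>2\<close>, whereas \<open>\<theta>\<^sup>1\<^sup>+\<^sup>p = \<theta> a\<^sup>-\<^sup>3\<close>.  For large \<open>a\<close> the former exceeds any
  constant multiple of the latter.
\<close>

section \<open>A lower bound for the tails of sums of symmetric variables\<close>

text \<open>
  A variant of Levy's inequality: a sum of independent symmetric variables is at least half as
  likely to be large as some summand.  The reason is that \<open>z + t\<close> and \<open>z - t\<close> cannot both lie in
  \<open>(-a, a)\<close> when \<open>\<bar>t\<bar> \<ge> a\<close>.  The shift \<open>y\<close> makes an induction on the index set possible: conditioned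
  on one summand, the sum of the others is shifted by its value.
\<close>

lemma (in prob_space) levy_symmetrization:
  fixes X :: "'i \<Rightarrow> 'a \<Rightarrow> real"
  assumes "finite I" and "indep_vars (\<lambda>_. borel) X I"
    and "\<And>i. i \<in> I \<Longrightarrow> distr M borel (\<lambda>\<omega>. - X i \<omega>) = distr M borel (X i)"
  shows "1 - (\<Prod>i\<in>I. prob {\<omega>\<in>space M. \<bar>X i \<omega>\<bar> < a})
           \<le> 2 * prob {\<omega>\<in>space M. a \<le> \<bar>y + (\<Sum>i\<in>I. X i \<omega>)\<bar>}"
  using assms
proof (induction I arbitrary: y rule: finite_induct)
  case empty
  then show ?case by simp
next
  case (insert j I)
  define S where "S = (\<lambda>\<omega>. \<Sum>i\<in>I. X i \<omega>)"
  define T where "T = X j"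
  define \<pi> where "\<pi> = (\<Prod>i\<in>I. prob {\<omega>\<in>space M. \<bar>X i \<omega>\<bar> < a})"
  define g where "g t = prob {\<omega>\<in>space M. a \<le> \<bar>y + t + S \<omega>\<bar>}" for t
  have meas: "random_variable borel (X i)" if "i \<in> insert j I" for i
    using insert.prems(1) that unfolding indep_vars_def by blast
  have [measurable]: "random_variable borel T" "random_variable borel S"
    unfolding T_def S_def using meas by auto
  have \<pi>: "0 \<le> \<pi>" "\<pi> \<le> 1"
    unfolding \<pi>_def by (auto intro!: prod_nonneg prod_le_1)
  interpret DT: prob_space "distr M borel T" by (rule prob_space_distr) simp
  interpret DS: prob_space "distr M borel S" by (rule prob_space_distr) simp
  interpret P: pair_prob_space "distr M borel T" "distr M borel S" ..
  define A where "A = {z::real\<times>real. a \<le> \<bar>y + fst z + snd z\<bar>}"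
  have A [measurable]: "A \<in> sets (borel \<Otimes>\<^sub>M borel)"
  proof -
    have "A = {z \<in> space (borel \<Otimes>\<^sub>M borel). a \<le> \<bar>y + fst z + snd z\<bar>}"
      by (simp add: A_def space_pair_measure)
    also have "\<dots> \<in> sets (borel \<Otimes>\<^sub>M borel)"
      by measurable
    finally show ?thesis .
  qed
  have A': "A \<in> sets (distr M borel T \<Otimes>\<^sub>M distr M borel S)"
  proof -
    have "sets (distr M borel T \<Otimes>\<^sub>M distr M borel S) = sets (borel \<Otimes>\<^sub>M borel)"
      by (rule sets_pair_measure_cong) auto
    with A show ?thesis by simp
  qed
  have g_alt: "g t = measure (distr M borel S) (Pair t -` A)" for t
  proof -
    have "Pair t -` A \<in> sets borel"
      using A by (rule sets_Pair1)
    then have "measure (distr M borel S) (Pair t -` A) = prob (S -` (Pair t -` A) \<inter> space M)"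
      by (intro measure_distr) auto
    also have "S -` (Pair t -` A) \<inter> space M = {\<omega>\<in>space M. a \<le> \<bar>y + t + S \<omega>\<bar>}"
      by (auto simp: A_def)
    finally show ?thesis by (simp add: g_def)
  qed
  have g_meas [measurable]: "g \<in> borel_measurable borel"
  proof -
    have "(\<lambda>t. emeasure (distr M borel S) (Pair t -` A)) \<in> borel_measurable (distr M borel T)"
      using A' by (rule DS.measurable_emeasure_Pair)
    then have "(\<lambda>t. enn2real (emeasure (distr M borel S) (Pair t -` A))) \<in> borel_measurable borel"
      by simp
    also have "(\<lambda>t. enn2real (emeasure (distr M borel S) (Pair t -` A))) = g"
      by (rule ext) (simp only: g_alt measure_def)
    finally show ?thesis .
  qed
  have g01: "0 \<le> g t" "g t \<le> 1" for t
    unfolding g_def by auto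
  have g_int: "integrable M (\<lambda>\<omega>. g (f \<omega>))" if "random_variable borel f" for f
    using that by (intro integrable_const_bound[where B=1]) (auto simp: g01)
  have indep: "indep_var borel T borel S"
    unfolding T_def S_def by (rule indep_vars_sum) (use insert in auto)
  (* Conditioning on the summand T turns the tail probability into the mean of g (T), and the
     symmetry of T allows this mean to be replaced by that of (g (T) + g (- T)) / 2. *)
  have "prob {\<omega>\<in>space M. a \<le> \<bar>y + (\<Sum>i\<in>insert j I. X i \<omega>)\<bar>}
      = measure (distr M (borel \<Otimes>\<^sub>M borel) (\<lambda>\<omega>. (T \<omega>, S \<omega>))) A"
  proof -
    have "{\<omega>\<in>space M. a \<le> \<bar>y + (\<Sum>i\<in>insert j I. X i \<omega>)\<bar>} = (\<lambda>\<omega>. (T \<omega>, S \<omega>)) -` A \<inter> space M"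
      using insert.hyps by (auto simp: A_def S_def T_def add.assoc)
    then show ?thesis
      by (simp add: measure_distr)
  qed
  also have "\<dots> = measure (distr M borel T \<Otimes>\<^sub>M distr M borel S) A"
    using indep by (simp add: indep_var_distribution_eq)
  also have "\<dots> = (\<integral>t. g t \<partial>distr M borel T)"
  proof -
    have "emeasure (distr M borel T \<Otimes>\<^sub>M distr M borel S) A
        = (\<integral>\<^sup>+t. emeasure (distr M borel S) (Pair t -` A) \<partial>distr M borel T)"
      using A' by (rule DS.emeasure_pair_measure_alt)
    also have "\<dots> = (\<integral>\<^sup>+t. ennreal (g t) \<partial>distr M borel T)"
      by (simp add: g_alt DS.emeasure_eq_measure)
    finally show ?thesis
      by (subst integral_eq_nn_integral) (auto simp: g01 measure_def)
  qed
  finally have prob_eq: "prob {\<omega>\<in>space M. a \<le> \<bar>y + (\<Sum>i\<in>insert j I. X i \<omega>)\<bar>}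
      = (\<integral>t. g t \<partial>distr M borel T)" .
  have eq1: "(\<integral>t. g t \<partial>distr M borel T) = expectation (\<lambda>\<omega>. g (T \<omega>))"
    by (simp add: integral_distr)
  have "(\<integral>t. g t \<partial>distr M borel T) = (\<integral>t. g t \<partial>distr M borel (\<lambda>\<omega>. - T \<omega>))"
    using insert.prems(2)[of j] by (simp add: T_def)
  also have "\<dots> = expectation (\<lambda>\<omega>. g (- T \<omega>))"
    by (simp add: integral_distr)
  finally have "2 * prob {\<omega>\<in>space M. a \<le> \<bar>y + (\<Sum>i\<in>insert j I. X i \<omega>)\<bar>}
      = expectation (\<lambda>\<omega>. g (T \<omega>) + g (- T \<omega>))"
    using prob_eq eq1 by (simp add: g_int)
  also have "\<dots> \<ge> expectation (\<lambda>\<omega>. 1 - \<pi> * indicator {\<omega>\<in>space M. \<bar>T \<omega>\<bar> < a} \<omega>)"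
  proof (rule integral_mono)
    fix \<omega> assume "\<omega> \<in> space M"
    (* Without a large T, the induction hypothesis bounds each of the two terms; a large T moves the
       sum out of (-a, a) for at least one of the two signs. *)
    have half: "1 - \<pi> \<le> 2 * g t" for t
      unfolding g_def S_def \<pi>_def using insert.prems 
      by (intro insert.IH) (auto intro: indep_vars_subset)
    have one: "1 \<le> g t + g (- t)" if "a \<le> \<bar>t\<bar>" for t
    proof -
      have "1 = prob (space M)" by (simp add: prob_space)
      also have "\<dots> \<le> prob ({\<omega>\<in>space M. a \<le> \<bar>y + t + S \<omega>\<bar>} \<union> {\<omega>\<in>space M. a \<le> \<bar>y + - t + S \<omega>\<bar>})"
        using that by (intro finite_measure_mono) (auto simp: abs_if split: if_splits)
      also have "\<dots> \<le> g t + g (- t)"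
        unfolding g_def by (rule measure_Un_le) measurable
      finally show ?thesis .
    qed
    show "1 - \<pi> * indicator {\<omega>\<in>space M. \<bar>T \<omega>\<bar> < a} \<omega> \<le> g (T \<omega>) + g (- T \<omega>)"
      using half[of "T \<omega>"] half[of "- T \<omega>"] one[of "T \<omega>"] \<open>\<omega> \<in> space M\<close>
      by (cases "\<bar>T \<omega>\<bar> < a") auto
  next
    show "integrable M (\<lambda>\<omega>. 1 - \<pi> * indicator {\<omega>\<in>space M. \<bar>T \<omega>\<bar> < a} \<omega>)"
      using \<pi> by (intro integrable_const_bound[where B=1]) (auto simp: indicator_def)
  qed (auto intro!: g_int)
  also have "expectation (\<lambda>\<omega>. 1 - \<pi> * indicator {\<omega>\<in>space M. \<bar>T \<omega>\<bar> < a} \<omega>)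
      = 1 - \<pi> * prob {\<omega>\<in>space M. \<bar>T \<omega>\<bar> < a}"
  proof -
    let ?B = "{\<omega>\<in>space M. \<bar>T \<omega>\<bar> < a}"
    have "integrable M (indicator ?B :: 'a \<Rightarrow> real)"
      by (intro integrable_const_bound[where B=1]) (auto simp: indicator_def)
    moreover have "?B \<inter> space M = ?B" by auto
    ultimately show ?thesis
      by (subst Bochner_Integration.integral_diff) (simp_all add: prob_space)
  qed
  also have "\<dots> = 1 - (\<Prod>i\<in>insert j I. prob {\<omega>\<in>space M. \<bar>X i \<omega>\<bar> < a})"
    using insert.hyps by (simp add: \<pi>_def T_def mult.commute)
  finally show ?case .
qed

section \<open>Tails and the Kolmogorov distance\<close>

text \<open>
  The event that a variable is at least \<open>a\<close> in absolute value is described by its distribution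
  function at \<open>-a\<close> and just below \<open>a\<close>; hence the factor 2.  Evaluating at \<open>b < a\<close> avoids left limits
  of distribution functions.
\<close>

lemma tail_le_tail_plus_kolmogorov_dist:
  assumes "prob_space M" "prob_space N"
    and [measurable]: "X \<in> borel_measurable M" "Y \<in> borel_measurable N"
    and "0 \<le> b" "b < a"
  shows "measure N {\<omega>\<in>space N. a \<le> \<bar>Y \<omega>\<bar>}
           \<le> measure M {\<omega>\<in>space M. b \<le> \<bar>X \<omega>\<bar>} + 2 * kolmogorov_dist M X N Y"
proof -
  interpret M: prob_space M by fact
  interpret N: prob_space N by fact
  let ?F = "\<lambda>x. M.prob {\<omega>\<in>space M. X \<omega> \<le> x}" and ?G = "\<lambda>x. N.prob {\<omega>\<in>space N. Y \<omega> \<le> x}"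
  have "bdd_above (range (\<lambda>x. \<bar>?F x - ?G x\<bar>))"
  proof (rule bdd_aboveI2)
    show "\<bar>?F x - ?G x\<bar> \<le> 1" for x
      using M.prob_le_1[of "{\<omega>\<in>space M. X \<omega> \<le> x}"] N.prob_le_1[of "{\<omega>\<in>space N. Y \<omega> \<le> x}"]
        measure_nonneg[of M "{\<omega>\<in>space M. X \<omega> \<le> x}"] measure_nonneg[of N "{\<omega>\<in>space N. Y \<omega> \<le> x}"]
      by linarith
  qed
  then have K: "\<bar>?F x - ?G x\<bar> \<le> kolmogorov_dist M X N Y" for x
    unfolding kolmogorov_dist_def by (intro cSUP_upper) auto
  have "N.prob {\<omega>\<in>space N. a \<le> \<bar>Y \<omega>\<bar>}
      \<le> N.prob ({\<omega>\<in>space N. Y \<omega> \<le> - a} \<union> {\<omega>\<in>space N. \<not> Y \<omega> \<le> b})"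
    using assms by (intro N.finite_measure_mono) auto
  also have "\<dots> \<le> ?G (- a) + N.prob {\<omega>\<in>space N. \<not> Y \<omega> \<le> b}"
    by (rule measure_Un_le) measurable
  also have "N.prob {\<omega>\<in>space N. \<not> Y \<omega> \<le> b} = 1 - ?G b"
    by (rule N.prob_neg) measurable
  also have "?G (- a) + (1 - ?G b) \<le> ?F (- a) + (1 - ?F b) + 2 * kolmogorov_dist M X N Y"
    using K[of "- a"] K[of b] by linarith
  also have "1 - ?F b = M.prob {\<omega>\<in>space M. \<not> X \<omega> \<le> b}"
    by (rule M.prob_neg[symmetric]) measurable
  also have "?F (- a) + \<dots> = M.prob ({\<omega>\<in>space M. X \<omega> \<le> - a} \<union> {\<omega>\<in>space M. \<not> X \<omega> \<le> b})"
    using assms by (intro M.finite_measure_Union[symmetric]) auto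
  also have "\<dots> \<le> M.prob {\<omega>\<in>space M. b \<le> \<bar>X \<omega>\<bar>}"
    using assms by (intro M.finite_measure_mono) auto
  finally show ?thesis by simp
qed

text \<open>Markov's inequality for the moment of order \<open>2 m\<close>: the normal tail decays faster than any power.\<close>

lemma (in prob_space) std_normal_tail_le_moment:
  assumes "distributed M lborel \<xi> std_normal_density" and "0 < b"
  shows "prob {\<omega>\<in>space M. b \<le> \<bar>\<xi> \<omega>\<bar>} \<le> fact (2 * m) / (2 ^ m * fact m) / b ^ (2 * m)"
proof -
  have [measurable]: "\<xi> \<in> borel_measurable M"
    using distributed_measurable[OF assms(1)] by simp
  have E: "expectation (\<lambda>\<omega>. \<xi> \<omega> ^ (2 * m)) = fact (2 * m) / (2 ^ m * fact m)"
    using distributed_integral[OF assms(1), of "\<lambda>x. x ^ (2 * m)"] integral_std_normal_moment_even[of m]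
    by simp
  have int: "integrable M (\<lambda>\<omega>. \<xi> \<omega> ^ (2 * m))"
    using distributed_integrable[OF assms(1), of "\<lambda>x. x ^ (2 * m)"] integrable_std_normal_moment[of "2*m"]
    by simp
  have "prob {\<omega>\<in>space M. b \<le> \<bar>\<xi> \<omega>\<bar>} \<le> prob {\<omega>\<in>space M. b ^ (2 * m) \<le> \<xi> \<omega> ^ (2 * m)}"
  proof (rule finite_measure_mono)
    have "b ^ (2 * m) \<le> x ^ (2 * m)" if "b \<le> \<bar>x\<bar>" for x
      using power_mono[OF that, of "2 * m"] assms(2) by (simp add: power_even_abs)
    then show "{\<omega>\<in>space M. b \<le> \<bar>\<xi> \<omega>\<bar>} \<subseteq> {\<omega>\<in>space M. b ^ (2 * m) \<le> \<xi> \<omega> ^ (2 * m)}"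
      by auto
  qed measurable
  also have "\<dots> \<le> expectation (\<lambda>\<omega>. \<xi> \<omega> ^ (2 * m)) / b ^ (2 * m)"
    using int assms(2) by (intro integral_Markov_inequality_measure[where A="{}"]) auto
  finally show ?thesis unfolding E .
qed

section \<open>Triangular arrays with rare large jumps\<close>

text \<open>
  The mixture of the uniform distributions on \<open>{a, - a}\<close> and \<open>{s, - s}\<close> with weights \<open>q\<close> and \<open>1 - q\<close>.
  Drawing the sign separately from the magnitude makes the symmetry evident.
\<close>

definition jump_law :: "real \<Rightarrow> real \<Rightarrow> real \<Rightarrow> real pmf" where
  "jump_law q a s = map_pmf (\<lambda>(jump, sign). (if sign then 1 else - 1) * (if jump then a else s))
     (pair_pmf (bernoulli_pmf q) (bernoulli_pmf (1 / 2)))"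

lemma jump_law_expectation:
  fixes f :: "real \<Rightarrow> real"
  assumes "0 \<le> q" "q \<le> 1"
  shows "(\<integral>x. f x \<partial>jump_law q a s) = q * (f a + f (- a)) / 2 + (1 - q) * (f s + f (- s)) / 2"
  unfolding jump_law_def integral_map_pmf
  by (subst integral_measure_pmf[of UNIV])
     (use assms in \<open>auto simp: UNIV_bool pmf_pair field_simps simp flip: UNIV_Times_UNIV\<close>)

lemma jump_law_symmetric: "map_pmf uminus (jump_law q a s) = jump_law q a s"
proof -
  have flip: "map_pmf Not (bernoulli_pmf (1 / 2)) = bernoulli_pmf (1 / 2)"
  proof (rule pmf_eqI)
    fix i
    have "Not -` {i} = {\<not> i}" by auto
    then show "pmf (map_pmf Not (bernoulli_pmf (1 / 2))) i = pmf (bernoulli_pmf (1 / 2)) i"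
      by (cases i) (simp_all add: pmf_map measure_pmf_single)
  qed
  have "map_pmf uminus (jump_law q a s) =
     map_pmf (\<lambda>(jump, sign). (if sign then 1 else - 1) * (if jump then a else s))
       (map_pmf (map_prod id Not) (pair_pmf (bernoulli_pmf q) (bernoulli_pmf (1 / 2))))"
    unfolding jump_law_def pmf.map_comp by (intro map_pmf_cong) auto
  also have "map_pmf (map_prod id Not) (pair_pmf (bernoulli_pmf q) (bernoulli_pmf (1 / 2)))
     = pair_pmf (bernoulli_pmf q) (bernoulli_pmf (1 / 2))"
    using map_pair[of id Not "bernoulli_pmf q" "bernoulli_pmf (1/2)"] flip
    by (simp add: map_prod_def)
  finally show ?thesis unfolding jump_law_def .
qed


text \<open>
  The infinite product measure on the coordinate space realizes all rows at once; its coordinates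
  are independent even across rows.
\<close>

lemma row_iid_array_exists:
  fixes L :: "nat \<Rightarrow> real measure"
  assumes "\<And>n. prob_space (L n)" and [measurable_cong]: "\<And>n. sets (L n) = sets borel"
  obtains M :: "sample measure" and X :: "nat \<Rightarrow> nat \<Rightarrow> sample \<Rightarrow> real"
  where "prob_space M" and "\<And>n k. X n k \<in> borel_measurable M"
    and "\<And>n k. distr M borel (X n k) = L n"
    and "\<And>n. n \<ge> 1 \<Longrightarrow> prob_space.indep_vars M (\<lambda>_. borel) (X n) {1..n}"
proof -
  define D where "D = (\<lambda>i::nat \<times> nat. L (fst i))"
  define M where "M = PiM UNIV D"
  define X :: "nat \<Rightarrow> nat \<Rightarrow> sample \<Rightarrow> real" where "X = (\<lambda>n k \<omega>. \<omega> (n, k))"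
  have D: "prob_space (D i)" for i
    unfolding D_def by (rule assms(1))
  interpret prob_space M
    unfolding M_def by (rule prob_space_PiM) (rule D)
  have DX: "distr M borel (X n k) = L n" for n k
  proof -
    have "distr M borel (X n k) = distr M (D (n, k)) (\<lambda>\<omega>. \<omega> (n, k))"
      by (intro distr_cong) (auto simp: D_def X_def assms(2))
    also have "\<dots> = L n"
      unfolding M_def using distr_PiM_component[of UNIV D "(n, k)"] D by (simp add: D_def)
    finally show ?thesis .
  qed
  have XM: "X n k \<in> borel_measurable M" for n k
  proof -
    have "(\<lambda>\<omega>. \<omega> (n, k)) \<in> measurable M (D (n, k))"
      unfolding M_def by measurable
    then show ?thesis
      unfolding X_def by (simp add: D_def assms(2) cong: measurable_cong_sets)
  qed
  have "indep_vars (\<lambda>_. borel) (X n) {1..n}" if "n \<ge> 1" for n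
  proof (subst indep_vars_iff_distr_eq_PiM')
    have "distr M (PiM {1..n} (\<lambda>_. borel)) (\<lambda>x. \<lambda>k\<in>{1..n}. X n k x)
        = distr M (PiM {1..n} (\<lambda>k. D (n, k))) (\<lambda>\<omega>. \<lambda>k\<in>{1..n}. \<omega> (n, k))"
      by (intro distr_cong sets_PiM_cong) (auto simp: D_def X_def assms(2))
    also have "\<dots> = PiM {1..n} (\<lambda>k. D (n, k))"
      unfolding M_def by (rule distr_PiM_reindex) (auto simp: D inj_on_def)
    also have "\<dots> = PiM {1..n} (\<lambda>k. distr M borel (X n k))"
      by (simp add: DX D_def)
    finally show "distr M (PiM {1..n} (\<lambda>_. borel)) (\<lambda>x. \<lambda>k\<in>{1..n}. X n k x)
        = PiM {1..n} (\<lambda>k. distr M borel (X n k))" .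
  qed (use that XM in auto)
  with that[of M X] XM DX prob_space_axioms show thesis by blast
qed

text \<open>
  An array whose Lindeberg index is controlled by the variance \<open>\<theta>\<close> of its jumps, but whose
  row sums have tails of the order of the probability \<open>\<theta> / a\<^sup>2\<close> of a jump.
\<close>

lemma jump_array_exists:
  assumes "1 < a" and "0 < \<theta>" and "\<theta> < 1"
  obtains M :: "sample measure" and X :: "nat \<Rightarrow> nat \<Rightarrow> sample \<Rightarrow> real"
  where "standard_triangular_array M X" and "feller_negligible M X"
    and "0 \<le> lindeberg_index M X" and "lindeberg_index M X \<le> ereal \<theta>"
    and "\<And>n. n \<ge> 1 \<Longrightarrow> \<theta> / (4 * a\<^sup>2) \<le> measure M {\<omega>\<in>space M. a \<le> \<bar>\<Sum>k=1..n. X n k \<omega>\<bar>}"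
proof -
  define \<mu> where "\<mu> = \<theta> / a\<^sup>2"
  define q where "q n = \<mu> / real n" for n
  (* This value of s makes the variance of each entry of row n equal to 1 / n. *)
  define s where "s n = sqrt ((1 - \<theta>) / (real n - \<mu>))" for n
  define L where "L n = distr (measure_pmf (jump_law (q n) a (s n))) borel (\<lambda>x. x)" for n
  have "1 < a\<^sup>2" using assms by (simp add: one_less_power)
  then have \<mu>: "0 < \<mu>" "\<mu> < \<theta>" "\<mu> * a\<^sup>2 = \<theta>"
    using assms by (auto simp: \<mu>_def field_simps)
  have q: "0 \<le> q n" "q n \<le> 1" for n
  proof -
    show "0 \<le> q n" using \<mu> by (simp add: q_def)
    show "q n \<le> 1"
      using \<mu> assms by (cases "n = 0") (auto simp: q_def field_simps)
  qed
  have s: "0 \<le> s n" "(s n)\<^sup>2 = (1 - \<theta>) / (real n - \<mu>)" "(s n)\<^sup>2 \<le> 1 / real n" "s n < a"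
    if "n \<ge> 1" for n
  proof -
    have n: "1 \<le> real n" "\<mu> < real n" using that \<mu> assms by auto
    show "0 \<le> s n" "(s n)\<^sup>2 = (1 - \<theta>) / (real n - \<mu>)"
      using n assms by (auto simp: s_def)
    have "\<mu> \<le> \<theta> * real n"
    proof -
      have "\<theta> * 1 \<le> \<theta> * real n"
        using n(1) assms by (intro mult_left_mono) auto
      with \<mu> show ?thesis by linarith
    qed
    then have "(1 - \<theta>) / (real n - \<mu>) \<le> 1 / real n"
      using n by (simp add: field_simps)
    with \<open>(s n)\<^sup>2 = _\<close> show "(s n)\<^sup>2 \<le> 1 / real n" by simp
    also have "\<dots> \<le> 1"
      using n by simp
    also note \<open>1 < a\<^sup>2\<close>
    finally show "s n < a"
      using assms by (intro power2_less_imp_less[of _ a]) auto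
  qed
  obtain M :: "sample measure" and X where M: "prob_space M" and X: "\<And>n k. X n k \<in> borel_measurable M"
    and DX: "\<And>n k. distr M borel (X n k) = L n"
    and indep: "\<And>n. n \<ge> 1 \<Longrightarrow> prob_space.indep_vars M (\<lambda>_. borel) (X n) {1..n}"
    by (rule row_iid_array_exists[of L]) (auto simp: L_def intro!: prob_space.prob_space_distr prob_space_measure_pmf)
  interpret prob_space M by fact
  have E: "(\<integral>\<omega>. f (X n k \<omega>) \<partial>M) = q n * (f a + f (- a)) / 2 + (1 - q n) * (f (s n) + f (- s n)) / 2"
    if "f \<in> borel_measurable borel" for f :: "real \<Rightarrow> real" and n k
  proof -
    have "(\<integral>\<omega>. f (X n k \<omega>) \<partial>M) = (\<integral>x. f x \<partial>L n)"
      unfolding DX[of n k, symmetric] using that X by (simp add: integral_distr)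
    also have "\<dots> = (\<integral>x. f x \<partial>jump_law (q n) a (s n))"
      unfolding L_def using that by (simp add: integral_distr)
    finally show ?thesis by (simp add: jump_law_expectation[OF q])
  qed
  have var: "(\<integral>\<omega>. (X n k \<omega>)\<^sup>2 \<partial>M) = 1 / real n" if "n \<ge> 1" for n k
  proof -
    have "\<mu> < real n" using that \<mu> assms by auto
    then have "(1 - q n) * (s n)\<^sup>2 = (1 - \<theta>) / real n"
      using that by (simp add: s(2) q_def field_simps)
    moreover have "q n * a\<^sup>2 = \<theta> / real n"
      using \<mu> by (simp add: q_def)
    ultimately show ?thesis
      using that by (subst E) (auto simp: field_simps)
  qed
  have int: "integrable M (\<lambda>\<omega>. (X n k \<omega>)\<^sup>2)" if "n \<ge> 1" for n k
    using var[OF that, of k] that not_integrable_integral_eq by fastforce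
  have sta: "standard_triangular_array M X"
    unfolding standard_triangular_array_def using M X indep int
    by (auto simp: var E[of "\<lambda>x. x"])
  have feller: "feller_negligible M X"
    unfolding feller_negligible_def
  proof (rule Lim_transform_eventually)
    show "(\<lambda>n. 1 / real n) \<longlonglongrightarrow> 0" by (rule lim_1_over_n)
    show "\<forall>\<^sub>F n in sequentially. 1 / real n = Max ((\<lambda>k. \<integral>\<omega>. (X n k \<omega>)\<^sup>2 \<partial>M) ` {1..n})"
      using eventually_ge_at_top[of 1]
    proof eventually_elim
      case (elim n)
      then have "(\<lambda>k. \<integral>\<omega>. (X n k \<omega>)\<^sup>2 \<partial>M) ` {1..n} = {1 / real n}"
        by (auto simp: var image_def)
      then show ?case by simp
    qed
  qed
  let ?R = "\<lambda>\<epsilon> n. \<Sum>k=1..n. LINT \<omega>:{\<omega>\<in>space M. \<bar>X n k \<omega>\<bar> \<ge> \<epsilon>}|M. (X n k \<omega>)\<^sup>2"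
  have R0: "0 \<le> ?R \<epsilon> n" for \<epsilon> n
    by (intro sum_nonneg) (auto simp: set_lebesgue_integral_def intro!: integral_nonneg)
  have R: "\<forall>\<^sub>F n in sequentially. ?R \<epsilon> n \<le> \<theta>" if "\<epsilon> > 0" for \<epsilon>
  proof -
    have "(\<lambda>n. 1 / real n) \<longlonglongrightarrow> 0" by (rule lim_1_over_n)
    then have "\<forall>\<^sub>F n in sequentially. 1 / real n < \<epsilon>\<^sup>2"
      by (rule order_tendstoD) (use that in auto)
    then show ?thesis
      using eventually_ge_at_top[of 1]
    proof eventually_elim
      case (elim n)
      (* From here on only the jumps exceed the truncation level. *)
      have "s n < \<epsilon>"
        using s(3)[OF elim(2)] elim that by (intro power2_less_imp_less[of _ \<epsilon>]) auto
      have "(LINT \<omega>:{\<omega>\<in>space M. \<bar>X n k \<omega>\<bar> \<ge> \<epsilon>}|M. (X n k \<omega>)\<^sup>2) \<le> q n * a\<^sup>2" for k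
      proof -
        have "(LINT \<omega>:{\<omega>\<in>space M. \<bar>X n k \<omega>\<bar> \<ge> \<epsilon>}|M. (X n k \<omega>)\<^sup>2)
            = (\<integral>\<omega>. (\<lambda>x. indicator {x. \<epsilon> \<le> \<bar>x\<bar>} x * x\<^sup>2) (X n k \<omega>) \<partial>M)"
          unfolding set_lebesgue_integral_def
          by (intro Bochner_Integration.integral_cong) (auto simp: indicator_def)
        also have "\<dots> = q n * (indicator {x. \<epsilon> \<le> \<bar>x\<bar>} a * a\<^sup>2)"
          using \<open>s n < \<epsilon>\<close> s(1)[OF elim(2)] by (subst E) (auto simp: indicator_def)
        also have "\<dots> \<le> q n * a\<^sup>2"
          using q by (auto simp: indicator_def)
        finally show ?thesis .
      qed
      then have "?R \<epsilon> n \<le> real (card {1..n}) * (q n * a\<^sup>2)"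
        by (intro sum_bounded_above)
      also have "\<dots> = \<theta>"
        using elim \<mu> by (simp add: q_def)
      finally show ?case .
    qed
  qed
  have lin0: "0 \<le> lindeberg_index M X"
  proof -
    have "0 = limsup (\<lambda>n. 0 :: ereal)" by (simp add: Limsup_const)
    also have "\<dots> \<le> limsup (\<lambda>n. ereal (?R 1 n))"
      by (intro Limsup_mono always_eventually) (use R0[of 1] in auto)
    also have "\<dots> \<le> lindeberg_index M X"
      unfolding lindeberg_index_def by (rule SUP_upper) simp
    finally show ?thesis .
  qed
  have lin1: "lindeberg_index M X \<le> ereal \<theta>"
    unfolding lindeberg_index_def
  proof (rule SUP_least)
    fix \<epsilon> :: real assume "\<epsilon> \<in> {0<..}"
    then show "limsup (\<lambda>n. ereal (?R \<epsilon> n)) \<le> ereal \<theta>"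
      by (intro Limsup_bounded) (use R[of \<epsilon>] in simp)
  qed
  have tail: "\<theta> / (4 * a\<^sup>2) \<le> prob {\<omega>\<in>space M. a \<le> \<bar>\<Sum>k=1..n. X n k \<omega>\<bar>}" if "n \<ge> 1" for n
  proof -
    have small: "prob {\<omega>\<in>space M. \<bar>X n k \<omega>\<bar> < a} = 1 - q n" for k
    proof -
      have "prob {\<omega>\<in>space M. \<bar>X n k \<omega>\<bar> < a} = (\<integral>\<omega>. indicator {x. \<bar>x\<bar> < a} (X n k \<omega>) \<partial>M)"
      proof -
        have "(\<integral>\<omega>. indicator {x. \<bar>x\<bar> < a} (X n k \<omega>) \<partial>M)
            = (\<integral>\<omega>. indicator {\<omega>\<in>space M. \<bar>X n k \<omega>\<bar> < a} \<omega> \<partial>M :: real)"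
          by (intro Bochner_Integration.integral_cong) (auto simp: indicator_def)
        also have "\<dots> = prob ({\<omega>\<in>space M. \<bar>X n k \<omega>\<bar> < a} \<inter> space M)"
          by (rule Bochner_Integration.integral_indicator)
        also have "{\<omega>\<in>space M. \<bar>X n k \<omega>\<bar> < a} \<inter> space M = {\<omega>\<in>space M. \<bar>X n k \<omega>\<bar> < a}"
          by auto
        finally show ?thesis by simp
      qed
      also have "\<dots> = 1 - q n"
        using s[OF that] assms by (subst E) (auto simp: indicator_def)
      finally show ?thesis .
    qed
    have sym: "distr M borel (\<lambda>\<omega>. - X n k \<omega>) = distr M borel (X n k)" for k
    proof -
      have "distr M borel (\<lambda>\<omega>. - X n k \<omega>) = distr (distr M borel (X n k)) borel uminus"
        using X by (simp add: distr_distr o_def)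
      also have "\<dots> = distr (measure_pmf (jump_law (q n) a (s n))) borel uminus"
        unfolding DX L_def by (simp add: distr_distr o_def)
      also have "\<dots> = distr (measure_pmf (map_pmf uminus (jump_law (q n) a (s n)))) borel (\<lambda>x. x)"
        unfolding map_pmf_rep_eq by (simp add: distr_distr o_def)
      finally show ?thesis by (simp add: jump_law_symmetric DX L_def)
    qed
    have "1 - (1 - q n) ^ n \<le> 2 * prob {\<omega>\<in>space M. a \<le> \<bar>\<Sum>k=1..n. X n k \<omega>\<bar>}"
      using levy_symmetrization[of "{1..n}" "X n" a 0] indep[OF that] sym by (simp add: small)
    moreover have "(1 - q n) ^ n \<le> exp (- \<mu>)"
    proof -
      have "(1 - q n) ^ n \<le> exp (- q n) ^ n"
        using q[of n] exp_ge_add_one_self[of "- q n"] by (intro power_mono) auto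
      also have "\<dots> = exp (- \<mu>)"
        using that by (simp add: q_def flip: exp_of_nat_mult)
      finally show ?thesis .
    qed
    moreover have "exp (- \<mu>) \<le> 1 - \<mu> / 2"
    proof -
      have "exp (- \<mu>) \<le> 1 / (1 + \<mu>)"
        using \<mu> exp_ge_add_one_self[of \<mu>] by (simp add: exp_minus divide_simps)
      also have "\<dots> \<le> 1 - \<mu> / 2"
        using \<mu> assms mult_left_mono[of \<mu> 1 \<mu>] by (simp add: field_simps)
      finally show ?thesis .
    qed
    ultimately show ?thesis
      by (simp add: \<mu>_def)
  qed
  show thesis
    using that[OF sta feller lin0 lin1 tail] by blast
qed

section \<open>Choosing the size of the jumps\<close>

text \<open>
  Dividing by \<open>a powr (- 3 / p - 2)\<close>, the two terms on the left become multiples of \<open>1 / a\<close> and of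
  \<open>a powr (3 / p + 2 - 2 * m)\<close>, both of which vanish as \<open>a\<close> grows, while the right-hand side
  becomes \<open>1 / 4\<close>.
\<close>

lemma jump_size_exists:
  fixes p C c :: real
  assumes "p > 0" and "C > 0" and "2 * real m > 3 / p + 2"
  shows "\<exists>a>1. 2 * C * (a powr (- 3 / p)) powr (1 + p) + c / (a / 2) ^ (2 * m) < a powr (- 3 / p) / (4 * a\<^sup>2)"
proof -
  define r where "r = 3 / p"
  have r: "r * p = 3" "r > 0" using assms by (auto simp: r_def)
  have "((\<lambda>a::real. 2 * C * a powr - 1 + c * 2 ^ (2 * m) * a powr (r + 2 - 2 * real m)) \<longlongrightarrow> 2 * C * 0 + c * 2 ^ (2 * m) * 0) at_top"
    using assms(3) by (intro tendsto_intros tendsto_neg_powr filterlim_ident) (auto simp: r_def)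
  then have "\<forall>\<^sub>F a in at_top. 2 * C * a powr - 1 + c * 2 ^ (2 * m) * a powr (r + 2 - 2 * real m) < 1 / 4"
    by (rule order_tendstoD) simp
  then have "\<forall>\<^sub>F a in at_top. 2 * C * a powr - 1 + c * 2 ^ (2 * m) * a powr (r + 2 - 2 * real m) < 1 / 4 \<and> (1::real) < a"
    using eventually_gt_at_top by (rule eventually_conj)
  then obtain a :: real where a: "1 < a"
    "2 * C * a powr - 1 + c * 2 ^ (2 * m) * a powr (r + 2 - 2 * real m) < 1 / 4"
    by (metis (mono_tags, lifting) eventually_happens trivial_limit_at_top_linorder)
  have e1: "a powr (- r - 2) = a powr - r / a\<^sup>2"
    using a by (simp add: powr_diff powr_realpow flip: powr_numeral)
  have e2: "a powr - 1 * a powr (- r - 2) = (a powr - r) powr (1 + p)"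
  proof -
    have "a powr - 1 * a powr (- r - 2) = a powr (- 1 + (- r - 2))"
      by (rule powr_add[symmetric])
    also have "- 1 + (- r - 2) = - r * (1 + p)"
      using r by (simp add: algebra_simps)
    finally show ?thesis by (simp add: powr_powr)
  qed
  have e3: "a powr (r + 2 - 2 * real m) * a powr (- r - 2) = 1 / a ^ (2 * m)"
    using a by (simp add: powr_minus_divide powr_realpow[symmetric] flip: powr_add)
  have "2 * C * (a powr - r) powr (1 + p) + c / (a / 2) ^ (2 * m)
      = 2 * C * (a powr - 1 * a powr (- r - 2))
        + c * 2 ^ (2 * m) * (a powr (r + 2 - 2 * real m) * a powr (- r - 2))"
    unfolding e2 e3 by (simp add: power_divide)
  also have "\<dots> = (2 * C * a powr - 1 + c * 2 ^ (2 * m) * a powr (r + 2 - 2 * real m)) * a powr (- r - 2)"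
    by (simp only: distrib_right mult.assoc)
  also have "\<dots> < 1 / 4 * a powr (- r - 2)"
    using a by (intro mult_strict_right_mono) auto
  also have "\<dots> = a powr - r / (4 * a\<^sup>2)"
    unfolding e1 by simp
  finally have "2 * C * (a powr - r) powr (1 + p) + c / (a / 2) ^ (2 * m) < a powr - r / (4 * a\<^sup>2)" .
  with a(1) show ?thesis by (auto simp: r_def)
qed

section \<open>No superlinear bound by the Lindeberg index\<close>

theorem theorem4p3:
  fixes N :: "'b measure" and \<xi> :: "'b \<Rightarrow> real"
  assumes "prob_space N"
    and "distributed N lborel \<xi> std_normal_density"
  shows "\<not> (\<exists>p::real. p > 0 \<and> (\<exists>C::real. C > 0 \<and>
    (\<forall>(M :: sample measure) (X :: nat \<Rightarrow> nat \<Rightarrow> sample \<Rightarrow> real).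
       standard_triangular_array M X \<longrightarrow> feller_negligible M X \<longrightarrow>
       limsup (\<lambda>n. ereal (kolmogorov_dist N \<xi> M (\<lambda>\<omega>. \<Sum>k=1..n. X n k \<omega>)))
         \<le> ereal (C * real_of_ereal (lindeberg_index M X) powr (1 + p)))))"
proof safe
  fix p C :: real
  assume p: "p > 0" and C: "C > 0" and bound: "\<forall>(M :: sample measure) X.
       standard_triangular_array M X \<longrightarrow> feller_negligible M X \<longrightarrow>
       limsup (\<lambda>n. ereal (kolmogorov_dist N \<xi> M (\<lambda>\<omega>. \<Sum>k=1..n. X n k \<omega>)))
         \<le> ereal (C * real_of_ereal (lindeberg_index M X) powr (1 + p))"
  obtain m :: nat where "real m > 3 / p + 2"
    using reals_Archimedean2 by blast
  then have m: "2 * real m > 3 / p + 2"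
    by linarith
  define c :: real where "c = fact (2 * m) / (2 ^ m * fact m)"
  obtain a where a: "1 < a"
    "2 * C * (a powr (- 3 / p)) powr (1 + p) + c / (a / 2) ^ (2 * m) < a powr (- 3 / p) / (4 * a\<^sup>2)"
    using jump_size_exists[OF p C m, of c] by blast
  define \<theta> where "\<theta> = a powr (- 3 / p)"
  have \<theta>: "0 < \<theta>" "\<theta> < 1"
    using a p by (auto simp: \<theta>_def powr_less_one)
  obtain M :: "sample measure" and X where sta: "standard_triangular_array M X" and feller: "feller_negligible M X"
    and lin: "0 \<le> lindeberg_index M X" "lindeberg_index M X \<le> ereal \<theta>"
    and tail: "\<And>n. n \<ge> 1 \<Longrightarrow> \<theta> / (4 * a\<^sup>2) \<le> measure M {\<omega>\<in>space M. a \<le> \<bar>\<Sum>k=1..n. X n k \<omega>\<bar>}"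
    by (rule jump_array_exists[OF a(1) \<theta>]) blast
  interpret N: prob_space N by fact
  interpret M: prob_space M
    using sta by (simp add: standard_triangular_array_def)
  have \<xi>: "\<xi> \<in> borel_measurable N"
    using distributed_measurable[OF assms(2)] by simp
  define d where "d = (\<theta> / (4 * a\<^sup>2) - c / (a / 2) ^ (2 * m)) / 2"
  have "d \<le> kolmogorov_dist N \<xi> M (\<lambda>\<omega>. \<Sum>k=1..n. X n k \<omega>)" if "n \<ge> 1" for n
  proof -
    have [measurable]: "X n k \<in> borel_measurable M" if "k \<in> {1..n}" for k
      using sta \<open>n \<ge> 1\<close> that by (auto simp: standard_triangular_array_def)
    have "\<theta> / (4 * a\<^sup>2) \<le> M.prob {\<omega>\<in>space M. a \<le> \<bar>\<Sum>k=1..n. X n k \<omega>\<bar>}"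
      by (rule tail) fact
    also have "\<dots> \<le> N.prob {\<omega>\<in>space N. a / 2 \<le> \<bar>\<xi> \<omega>\<bar>}
        + 2 * kolmogorov_dist N \<xi> M (\<lambda>\<omega>. \<Sum>k=1..n. X n k \<omega>)"
      using a(1) \<xi> assms(1)
      by (intro tail_le_tail_plus_kolmogorov_dist M.prob_space_axioms) auto
    also have "N.prob {\<omega>\<in>space N. a / 2 \<le> \<bar>\<xi> \<omega>\<bar>} \<le> c / (a / 2) ^ (2 * m)"
      unfolding c_def using a(1) by (intro N.std_normal_tail_le_moment assms(2)) auto
    finally show ?thesis by (simp add: d_def)
  qed
  then have "ereal d \<le> limsup (\<lambda>n. ereal (kolmogorov_dist N \<xi> M (\<lambda>\<omega>. \<Sum>k=1..n. X n k \<omega>)))"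
    by (intro le_Limsup) (auto simp: eventually_at_top_linorder intro!: exI[of _ 1])
  also have "\<dots> \<le> ereal (C * real_of_ereal (lindeberg_index M X) powr (1 + p))"
    using bound sta feller by blast
  also have "\<dots> \<le> ereal (C * \<theta> powr (1 + p))"
  proof -
    have "real_of_ereal (lindeberg_index M X) \<le> \<theta>" "0 \<le> real_of_ereal (lindeberg_index M X)"
      using lin by (cases "lindeberg_index M X"; auto)+
    then show ?thesis
      using C p by (auto intro!: mult_left_mono powr_mono2)
  qed
  finally show False
    using a(2) by (simp add: d_def \<theta>_def)
qed

end
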